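(* Suppose that the nonlinear boundary-value problem $$x'(t,\varepsilon)=B(t)x(t,\varepsilon)+\varepsilon H(t,x(t,\varepsilon))+g(t),\quad t\in J,\qquad l\,x(\cdot,\varepsilon)=\alpha,$$ has a strong generalized solution $x(t,\varepsilon)$ (for small $\varepsilon$, depending continuously on $\varepsilon$) which for $\varepsilon=0$ turns into one of the strong generalized solutions $x_0(t,c^0)$, $x(t,0)=x_0(t,c^0)$, of the generating boundary-value problem $$x_0'(t)=B(t)x_0(t)+g(t),\qquad l\,x_0(\cdot)=\alpha .$$ Then the element $c=c^0$ satisfies the operator equation for the generating elements $$F(c):=\mathcal P_{\overline{\mathcal H}_{\overline Q}}\; l\int_0^{\cdot}U(\cdot)U^{-1}(\tau)H(\tau,x_0(\tau,c))\,d\tau=0 .$$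
   Context: Setting. $\mathcal H$ is a separable Hilbert space, $\mathcal H_1$ a Hilbert space, $J=[0,w]\subset\mathbb R$. $A(t)$, $t\in J$, is a strongly continuous family of closed operators in $\mathcal H$ with dense domain $D=D(A(t))$ independent of $t$; $f\in C(J,\mathcal H)$; $\alpha\in\mathcal H_1$; $l:C^2(J,\mathcal H)\times C^1(J,\mathcal H)\to\mathcal H_1$ is a bounded linear map; $\varepsilon$ is a small parameter. The abstract hyperbolic problem is $y''+A(t)y=\varepsilon Z(t,y,y')+f(t)$, $l(y(\cdot,\varepsilon),y'(\cdot,\varepsilon))=\alpha$. The nonlinearity $Z(t,y,y')$ is continuous in $t$ and strongly continuously Fréchet differentiable in its second and third arguments in a neighbourhood (of sufficiently small radius $q$) of the generating solution. First-order form. Put $x=\mathrm{col}(x_1,x_2)=\mathrm{col}(y,y')\in\mathcal K:=\mathcal H\times\mathcal H$, $$B(t)=\begin{pmatrix}O&I\\-A(t)&O\end{pmatrix},\quad g(t)=\mathrm{col}(0,f(t)),\quad H(t,x)=\mathrm{col}(0,Z(t,x_1,x_2)),\quad lx:=l(x_1,x_2).$$ $U(t)$ is the evolution operator: $U'(t)=B(t)U(t)$, $U(0)=I$. Set $$Q=lU(\cdot):\mathcal K\to\mathcal H_1 \ \text{(linear, bounded)},\qquad g_1=\alpha-l\int_0^{\cdot}U(\cdot)U^{-1}(\tau)g(\tau)\,d\tau .$$ Extension of $Q$. Let $X=N(Q)^{\perp}$, and let $\overline X$ be the completion of $X$ in the norm $\|x\|_{\overline X}=\|Qx\|_{\mathcal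 H_1}$. The restriction $Q|_X$ extends by continuity to a homeomorphism $\overline{\mathcal Q}:\overline X\to\overline{R(Q)}$. Put $\overline{\mathcal K}=N(Q)\oplus\overline X$ and $\overline Q=\overline{\mathcal Q}\,\mathcal P_{\overline X}:\overline{\mathcal K}\to\mathcal H_1$, where $\mathcal P_{\overline X}$ is the projection onto $\overline X$. Then $R(\overline Q)=\overline{R(Q)}$ is closed and $\overline Q$ has a Moore–Penrose pseudoinverse $\overline Q^{+}$. (If $R(Q)$ is closed, then $\overline{\mathcal K}=\mathcal K$ and $\overline Q=Q$.) $\mathcal P_{N(\overline Q)}$ is the orthoprojector onto $N(\overline Q)$. $\mathcal P_{\overline{\mathcal H}_{\overline Q}}$ is the orthoprojector onto $\overline{\mathcal H}_{\overline Q}$, the orthogonal complement of $R(\overline Q)$ in $\mathcal H_1$. Strong generalized solutions. For a right-hand side $h$, a strong generalized solution of $x'=B(t)x+h(t)$, $lx=\alpha$ is $x(t)=U(t)c+\int_0^tU(t)U^{-1}(\tau)h(\tau)d\tau$, where $c\in\overline{\mathcal K}$ satisfies $\overline Qc=\alpha-l\int_0^{\cdot}U(\cdot)U^{-1}(\tau)h(\tau)d\tau$ ($U(t)c$ for $c\in\overline{\mathcal K}$ is understood via extension of $U(t)$ to the completed space). For the nonlinear problem, take $h(t)=g(t)+\varepsilon H(t,x(t,\varepsilon))$. The strong generalized solutions of the generating problem are $$x_0(t,c)=U(t)\mathcal P_{N(\overline Q)}c+U(t)\overline Q^{+}g_1+\int_0^tU(t)U^{-1}(\tau)g(\tau)\,d\tau,\qquad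 c\in\overline{\mathcal K}.$$ The nonlinearity is continuous near the generating solution, so that $H(\tau,x(\tau,\varepsilon))\to H(\tau,x_0(\tau,c^0))$ as $\varepsilon\to0$ (uniformly in $\tau$). *)

theory Defs
  imports "HOL-Analysis.Analysis"
begin

section \<open>Hilbert space notions\<close>

text \<open>
  Hilbert spaces are types of sort \<open>{real_inner, banach}\<close>. A complex Hilbert space is covered
  through its underlying real structure with inner product \<open>Re \<langle>x, y\<rangle>\<close>: norms, kernels, orthogonal
  complements of complex subspaces, orthoprojectors and pseudoinverses are the same.
\<close>

definition linear_on_set :: "'a::real_vector set \<Rightarrow> ('a \<Rightarrow> 'b::real_vector) \<Rightarrow> bool" where
  "linear_on_set S T \<longleftrightarrow>
     (\<forall>x\<in>S. \<forall>y\<in>S. T (x + y) = T x + T y) \<and> (\<forall>x\<in>S. \<forall>r. T (r *\<^sub>R x) = r *\<^sub>R T x)"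

definition orthoprojector :: "'a::real_inner set \<Rightarrow> 'a \<Rightarrow> 'a" where
  "orthoprojector S x = (THE p. p \<in> S \<and> (\<forall>s\<in>S. (x - p) \<bullet> s = 0))"

text \<open>The four Penrose equations, for an operator with domain the subspace \<open>V\<close>.\<close>

definition is_moore_penrose ::
  "'a::real_inner set \<Rightarrow> ('a \<Rightarrow> 'b::real_inner) \<Rightarrow> ('b \<Rightarrow> 'a) \<Rightarrow> bool" where
  "is_moore_penrose V T S \<longleftrightarrow>
     bounded_linear S \<and> range S \<subseteq> V \<and>
     (\<forall>x\<in>V. T (S (T x)) = T x) \<and>
     (\<forall>y. S (T (S y)) = S y) \<and>
     (\<forall>y z. T (S y) \<bullet> z = y \<bullet> T (S z)) \<and>
     (\<forall>x\<in>V. \<forall>x'\<in>V. S (T x) \<bullet> x' = x \<bullet> S (T x'))"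

definition pseudoinverse :: "'a::real_inner set \<Rightarrow> ('a \<Rightarrow> 'b::real_inner) \<Rightarrow> 'b \<Rightarrow> 'a" where
  "pseudoinverse V T = (THE S. is_moore_penrose V T S)"

text \<open>
  \<open>Xbar\<close> together with the canonical map \<open>j\<close> is a completion of the subspace \<open>X\<close> in the norm \<open>nrm\<close>.
  It is a subset of a type, not a type, so that a completion always exists: for the norm
  \<open>\<lambda>x. norm (Q x)\<close> one may take \<open>j = Q\<close> and the closure of \<open>Q ` X\<close>.
\<close>

definition is_completion ::
  "'a::real_vector set \<Rightarrow> ('a \<Rightarrow> real) \<Rightarrow> ('a \<Rightarrow> 'x::real_normed_vector) \<Rightarrow> 'x set \<Rightarrow> bool" where
  "is_completion X nrm j Xbar \<longleftrightarrow>
     subspace Xbar \<and> complete Xbar \<and> linear_on_set X j \<and> (\<forall>x\<in>X. norm (j x) = nrm x) \<and>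
     j ` X \<subseteq> Xbar \<and> Xbar \<subseteq> closure (j ` X)"

text \<open>\<open>F\<close> is the extension by continuity of \<open>T\<close> from \<open>X\<close> to \<open>Y\<close>, where \<open>X\<close> is mapped into \<open>Y\<close> by \<open>i\<close>.\<close>

definition extends_by_continuity ::
  "'a set \<Rightarrow> ('a \<Rightarrow> 'b) \<Rightarrow> ('a \<Rightarrow> 'y::topological_space) \<Rightarrow> 'y set \<Rightarrow> ('y \<Rightarrow> 'b::topological_space) \<Rightarrow> bool"
  where
  "extends_by_continuity X T i Y F \<longleftrightarrow> continuous_on Y F \<and> (\<forall>x\<in>X. F (i x) = T x)"

section \<open>The spaces $C^k(J,\mathcal H)$ and the boundary operator\<close>

definition deriv_on :: "real set \<Rightarrow> (real \<Rightarrow> 'a::real_normed_vector) \<Rightarrow> real \<Rightarrow> 'a" where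
  "deriv_on J y = (\<lambda>t. vector_derivative y (at t within J))"

fun Ck_on :: "nat \<Rightarrow> real set \<Rightarrow> (real \<Rightarrow> 'a::real_normed_vector) \<Rightarrow> bool" where
  "Ck_on 0 J y \<longleftrightarrow> continuous_on J y"
| "Ck_on (Suc k) J y \<longleftrightarrow> (\<forall>t\<in>J. y differentiable (at t within J)) \<and> Ck_on k J (deriv_on J y)"

definition Ck_norm :: "nat \<Rightarrow> real set \<Rightarrow> (real \<Rightarrow> 'a::real_normed_vector) \<Rightarrow> real" where
  "Ck_norm k J y = (\<Sum>i\<le>k. SUP t\<in>J. norm ((deriv_on J ^^ i) y t))"

text \<open>
  Functions on \<open>J\<close> are total functions on the reals; the bound below makes \<open>l\<close> depend on their
  restrictions to \<open>J\<close> only. Outside $C^2 \times C^1$ nothing is known about \<open>l\<close>.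
\<close>

definition bounded_linear_C2_C1 ::
  "real set \<Rightarrow> ((real \<Rightarrow> 'h::real_normed_vector) \<Rightarrow> (real \<Rightarrow> 'h) \<Rightarrow> 'm::real_normed_vector) \<Rightarrow> bool"
  where
  "bounded_linear_C2_C1 J l \<longleftrightarrow>
     (\<forall>y1 y2 z1 z2. Ck_on 2 J y1 \<and> Ck_on 1 J y2 \<and> Ck_on 2 J z1 \<and> Ck_on 1 J z2 \<longrightarrow>
        l (\<lambda>t. y1 t + z1 t) (\<lambda>t. y2 t + z2 t) = l y1 y2 + l z1 z2) \<and>
     (\<forall>y1 y2 r. Ck_on 2 J y1 \<and> Ck_on 1 J y2 \<longrightarrow>
        l (\<lambda>t. r *\<^sub>R y1 t) (\<lambda>t. r *\<^sub>R y2 t) = r *\<^sub>R l y1 y2) \<and>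
     (\<exists>M. \<forall>y1 y2. Ck_on 2 J y1 \<and> Ck_on 1 J y2 \<longrightarrow>
        norm (l y1 y2) \<le> M * (Ck_norm 2 J y1 + Ck_norm 1 J y2))"

definition in_C2_C1 :: "real set \<Rightarrow> (real \<Rightarrow> 'h \<times> 'h::real_normed_vector) \<Rightarrow> bool" where
  "in_C2_C1 J x \<longleftrightarrow> Ck_on 2 J (\<lambda>t. fst (x t)) \<and> Ck_on 1 J (\<lambda>t. snd (x t))"

definition bc :: "((real \<Rightarrow> 'h) \<Rightarrow> (real \<Rightarrow> 'h) \<Rightarrow> 'm) \<Rightarrow> (real \<Rightarrow> 'h \<times> 'h) \<Rightarrow> 'm" where
  "bc l x = l (\<lambda>t. fst (x t)) (\<lambda>t. snd (x t))"

section \<open>The linear evolution\<close>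

definition closed_operator_family ::
  "real set \<Rightarrow> 'h::real_normed_vector set \<Rightarrow> (real \<Rightarrow> 'h \<Rightarrow> 'h) \<Rightarrow> bool" where
  "closed_operator_family J D A \<longleftrightarrow>
     subspace D \<and> closure D = UNIV \<and>
     (\<forall>t\<in>J. linear_on_set D (A t) \<and> closed ((\<lambda>x. (x, A t x)) ` D)) \<and>
     (\<forall>x\<in>D. continuous_on J (\<lambda>t. A t x))"

definition B_op :: "(real \<Rightarrow> 'h \<Rightarrow> 'h::real_normed_vector) \<Rightarrow> real \<Rightarrow> 'h \<times> 'h \<Rightarrow> 'h \<times> 'h" where
  "B_op A t x = (snd x, - A t (fst x))"

text \<open>
  \<open>U' = B U\<close>, \<open>U 0 = I\<close> in the strong sense: \<open>U t\<close> and \<open>inv (U t)\<close> are bounded and strongly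
  continuous, and orbits that start in the domain \<open>D \<times> UNIV\<close> of \<open>B t\<close> stay there and are
  continuously differentiable.
\<close>

definition evolution_operator ::
  "real set \<Rightarrow> 'h::real_normed_vector set \<Rightarrow> (real \<Rightarrow> 'h \<Rightarrow> 'h) \<Rightarrow> (real \<Rightarrow> 'h \<times> 'h \<Rightarrow> 'h \<times> 'h) \<Rightarrow> bool"
  where
  "evolution_operator J D A U \<longleftrightarrow>
     U 0 = id \<and>
     (\<forall>t\<in>J. bij (U t) \<and> bounded_linear (U t) \<and> bounded_linear (inv (U t))) \<and>
     (\<forall>c. continuous_on J (\<lambda>t. U t c) \<and> continuous_on J (\<lambda>t. inv (U t) c)) \<and>
     (\<forall>c \<in> D \<times> UNIV.
        (\<forall>t\<in>J. U t c \<in> D \<times> UNIV \<and>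
           ((\<lambda>s. U s c) has_vector_derivative B_op A t (U t c)) (at t within J)) \<and>
        continuous_on J (\<lambda>t. B_op A t (U t c)))"

definition duhamel ::
  "(real \<Rightarrow> 'k \<Rightarrow> 'k::real_normed_vector) \<Rightarrow> (real \<Rightarrow> 'k) \<Rightarrow> real \<Rightarrow> 'k" where
  "duhamel U h t = integral {0..t} (\<lambda>\<tau>. U t (inv (U \<tau>) (h \<tau>)))"

text \<open>
  \<open>Q\<close> is the bounded operator \<open>l U(\<cdot>)\<close>. Since \<open>l\<close> is only defined on $C^2 \times C^1$, the defining
  equation makes sense for initial values in the dense domain \<open>D \<times> UNIV\<close> (whose orbits are in
  $C^2 \times C^1$); boundedness then determines \<open>Q\<close> on the whole space.
\<close>

definition is_lU ::
  "'h::real_normed_vector set \<Rightarrow> ((real \<Rightarrow> 'h) \<Rightarrow> (real \<Rightarrow> 'h) \<Rightarrow> 'm::real_normed_vector) \<Rightarrow>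
   (real \<Rightarrow> 'h \<times> 'h \<Rightarrow> 'h \<times> 'h) \<Rightarrow> ('h \<times> 'h \<Rightarrow> 'm) \<Rightarrow> bool" where
  "is_lU D l U Q \<longleftrightarrow> bounded_linear Q \<and> (\<forall>c \<in> D \<times> UNIV. Q c = bc l (\<lambda>t. U t c))"

section \<open>Completed space and strong generalized solutions\<close>

definition nullspace :: "'k set \<Rightarrow> ('k \<Rightarrow> 'm::zero) \<Rightarrow> 'k set" where
  "nullspace V T = {c \<in> V. T c = 0}"

text \<open>
  The completed space is the Hilbert sum of \<open>N(Q)\<close> and \<open>Xbar\<close>, realised inside the product type;
  \<open>emb\<close> is the canonical map of the original space into it.
\<close>

definition emb ::
  "('k::real_inner \<Rightarrow> 'm::zero) \<Rightarrow> ('k \<Rightarrow> 'x) \<Rightarrow> 'k \<Rightarrow> 'k \<times> 'x" where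
  "emb Q j c = (orthoprojector (nullspace UNIV Q) c,
                j (orthoprojector (orthogonal_comp (nullspace UNIV Q)) c))"

definition strong_generalized_solution ::
  "real set \<Rightarrow> ((real \<Rightarrow> 'h) \<Rightarrow> (real \<Rightarrow> 'h) \<Rightarrow> 'm::real_normed_vector) \<Rightarrow>
   (real \<Rightarrow> 'h \<times> 'h \<Rightarrow> 'h \<times> 'h::real_normed_vector) \<Rightarrow>
   'kb::real_vector set \<Rightarrow> ('kb \<Rightarrow> 'm) \<Rightarrow> ('h \<times> 'h \<Rightarrow> 'kb) \<Rightarrow> (real \<Rightarrow> 'kb \<Rightarrow> 'kb) \<Rightarrow>
   'm \<Rightarrow> (real \<Rightarrow> 'h \<times> 'h) \<Rightarrow> (real \<Rightarrow> 'kb) \<Rightarrow> bool" where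
  "strong_generalized_solution J l U Kbar Qbar e Ubar \<alpha> h x \<longleftrightarrow>
     (\<exists>c\<in>Kbar. Qbar c = \<alpha> - bc l (duhamel U h) \<and>
        (\<forall>t\<in>J. x t = Ubar t c + e (duhamel U h t)))"

text \<open>
  \<open>Zbar\<close> is the nonlinearity \<open>Z(t, y, y')\<close> as a function on the completed space, given on the tube
  of radius \<open>q\<close> around a function \<open>x0\<close>; it is jointly continuous there. The derivative is taken in
  the pair \<open>(y, y')\<close> and is continuous in the strong operator topology.
\<close>

definition tube :: "real set \<Rightarrow> 'kb::metric_space set \<Rightarrow> real \<Rightarrow> (real \<Rightarrow> 'kb) \<Rightarrow> (real \<times> 'kb) set" where
  "tube J Kbar q x0 = {(t, x). t \<in> J \<and> x \<in> Kbar \<and> dist x (x0 t) < q}"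

definition smooth_nonlinearity ::
  "real set \<Rightarrow> 'kb::real_normed_vector set \<Rightarrow> ('h \<times> 'h \<Rightarrow> 'kb) \<Rightarrow> real \<Rightarrow> (real \<Rightarrow> 'kb) \<Rightarrow>
   (real \<Rightarrow> 'h \<Rightarrow> 'h \<Rightarrow> 'h::real_normed_vector) \<Rightarrow> (real \<Rightarrow> 'kb \<Rightarrow> 'h) \<Rightarrow> bool" where
  "smooth_nonlinearity J Kbar e q x0 Z Zbar \<longleftrightarrow>
     (\<forall>t y y'. (t, e (y, y')) \<in> tube J Kbar q x0 \<longrightarrow> Zbar t (e (y, y')) = Z t y y') \<and>
     continuous_on (tube J Kbar q x0) (\<lambda>(t, x). Zbar t x) \<and>
     (\<exists>DZ. \<forall>t\<in>J.
        (\<forall>x. (t, x) \<in> tube J Kbar q x0 \<longrightarrow> (Zbar t has_derivative DZ t x) (at x within Kbar)) \<and>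
        (\<forall>v\<in>Kbar. continuous_on {x. (t, x) \<in> tube J Kbar q x0} (\<lambda>x. DZ t x v)))"

end

theory Submission
  imports Defs
begin

text \<open>
  Subtracting the solvability conditions of the problem for \<open>\<epsilon> > 0\<close> and for \<open>\<epsilon> = 0\<close> and dividing by
  \<open>\<epsilon>\<close> shows that \<open>l\<close> of the Duhamel integral of \<open>H(\<cdot>, x(\<cdot>, \<epsilon>))\<close> is orthogonal to the orthogonal
  complement of the range of \<open>Qbar\<close>; then \<open>\<epsilon>\<close> tends to \<open>0\<close>. Since \<open>l\<close> is continuous only in the
  $C^2 \times C^1$ norm, the limit needs the Duhamel integral to be a bounded operator from \<open>C\<close> to
  $C^2 \times C^1$. It maps into that space by hypothesis, and boundedness is then automatic by the
  uniform boundedness principle.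
\<close>

section \<open>Functional analysis\<close>

text \<open>Baire category: the sets \<open>E n\<close> are closed and cover the space, so one of
  them contains a ball. Linearity then carries the bound on that ball to every vector.\<close>

theorem uniform_boundedness:
  fixes F :: "'i \<Rightarrow> 'a::banach \<Rightarrow> 'b::real_normed_vector"
  assumes F: "\<And>i. i \<in> I \<Longrightarrow> bounded_linear (F i)"
    and bdd: "\<And>x. \<exists>K. \<forall>i\<in>I. norm (F i x) \<le> K"
  shows "\<exists>M\<ge>0. \<forall>i\<in>I. \<forall>x. norm (F i x) \<le> M * norm x"
proof -
  define E where "E n = {x. \<forall>i\<in>I. norm (F i x) \<le> real n}" for n
  have E_eq: "E n = (\<Inter>i\<in>I. {x. norm (F i x) \<le> real n})" for n
    by (auto simp: E_def)
  have closed_E: "closed (E n)" for n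
    unfolding E_eq
    by (intro closed_INT ballI closed_Collect_le continuous_intros bounded_linear.continuous_on[OF F])
  have "\<exists>n. x \<in> E n" for x
  proof -
    obtain K where K: "\<forall>i\<in>I. norm (F i x) \<le> K" using bdd by blast
    obtain n where "K \<le> real n" using real_arch_simple by blast
    then have "x \<in> E n" using K order_trans by (auto simp: E_def)
    then show ?thesis ..
  qed
  then have union: "\<Union>(range E) = UNIV" by auto
  have "\<exists>n. interior (E n) \<noteq> {}"
  proof (rule ccontr)
    assume "\<not> ?thesis"
    then have "Met_TC.mtopology interior_of \<Union>(range E) = {}"
      using closed_E
      by (intro Met_TC.metric_Baire_category_alt) (auto simp: complete_UNIV)
    then show False by (simp add: union)
  qed
  then obtain n a r where r: "0 < r" "ball a r \<subseteq> E n"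
    by (metis all_not_in_conv mem_interior)
  have bound: "norm (F i x) \<le> (4 * real n / r) * norm x" if i: "i \<in> I" for i x
  proof (cases "x = 0")
    case True
    then show ?thesis using linear_0[OF bounded_linear.linear[OF F[OF i]]] by simp
  next
    case False
    \<comment> \<open>This puts \<open>a + s *\<^sub>R x\<close> at distance \<open>r / 2\<close>
      from \<open>a\<close>, so both points lie in \<open>E n\<close>. Their images under
      \<open>F i\<close> differ by at most \<open>2 * real n\<close>, whence the constant
      \<open>4 * real n / r\<close>.\<close>
    define s where "s = r / (2 * norm x)"
    have s: "s > 0" using False r by (simp add: s_def)
    have "a \<in> E n" "a + s *\<^sub>R x \<in> E n"
      using r False by (auto intro!: subsetD[OF r(2)] simp: dist_norm s_def)
    then have "norm (F i a) \<le> real n" "norm (F i (a + s *\<^sub>R x)) \<le> real n"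
      using i by (auto simp: E_def)
    moreover have "F i (a + s *\<^sub>R x) = F i a + s *\<^sub>R F i x"
      using bounded_linear.linear[OF F[OF i]] by (simp add: linear_add linear_scale)
    ultimately have "norm (s *\<^sub>R F i x) \<le> 2 * real n"
      by (smt (verit) add_diff_cancel_left' norm_triangle_ineq4)
    then have "s * norm (F i x) \<le> 2 * real n" using s by simp
    then show ?thesis using r False by (simp add: s_def field_simps)
  qed
  show ?thesis
    using bound r by (intro exI[of _ "4 * real n / r"]) auto
qed

text \<open>Convergent sequences are bounded, so Banach-Steinhaus gives one constant for all
  \<open>F n\<close>, and the estimate survives the limit.\<close>

lemma bounded_linear_limit:
  fixes F :: "nat \<Rightarrow> 'a::banach \<Rightarrow> 'b::real_normed_vector"
  assumes F: "\<And>n. bounded_linear (F n)"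
    and lim: "\<And>x. (\<lambda>n. F n x) \<longlonglongrightarrow> G x"
  shows "bounded_linear G"
proof -
  have "\<exists>K. \<forall>n\<in>UNIV. norm (F n x) \<le> K" for x
    using convergent_imp_Bseq[OF convergentI[OF lim[of x]]] by (auto simp: Bseq_def)
  then obtain M where M: "\<And>n x. norm (F n x) \<le> M * norm x"
    using uniform_boundedness[of UNIV F] F by auto
  show ?thesis
  proof (rule bounded_linear_intro)
    show "G (x + y) = G x + G y" for x y
      using tendsto_add[OF lim lim, of x y] lim[of "x + y"]
      by (simp add: linear_add[OF bounded_linear.linear[OF F]] LIMSEQ_unique)
    show "G (r *\<^sub>R x) = r *\<^sub>R G x" for r x
      using tendsto_scaleR[OF tendsto_const lim, of r x] lim[of "r *\<^sub>R x"]
      by (simp add: linear_scale[OF bounded_linear.linear[OF F]] LIMSEQ_unique)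
    show "norm (G x) \<le> norm x * M" for x
      using M by (intro LIMSEQ_le_const2[OF tendsto_norm[OF lim]]) (auto simp: mult.commute)
  qed
qed

text \<open>Strong continuity handles \<open>V s (h t)\<close> with a frozen argument. The rest,
  \<open>V s (h s - h t)\<close>, is small because strong continuity on a compact set makes the
  operators uniformly bounded. Applied to \<open>inv (U \<tau>)\<close>, this makes the Duhamel
  integrand continuous.\<close>

lemma continuous_on_strong_apply:
  fixes V :: "'t::metric_space \<Rightarrow> 'a::banach \<Rightarrow> 'b::real_normed_vector"
  assumes "compact J" and V: "\<And>t. t \<in> J \<Longrightarrow> bounded_linear (V t)"
    and strong: "\<And>c. continuous_on J (\<lambda>t. V t c)" and h: "continuous_on J h"
  shows "continuous_on J (\<lambda>t. V t (h t))"
proof -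
  have "\<exists>K. \<forall>t\<in>J. norm (V t c) \<le> K" for c
    using compact_imp_bounded[OF compact_continuous_image[OF strong \<open>compact J\<close>]]
    by (auto simp: bounded_iff)
  then obtain M where M: "\<And>t c. t \<in> J \<Longrightarrow> norm (V t c) \<le> M * norm c"
    using uniform_boundedness[of J V] V by meson
  show ?thesis
    unfolding continuous_on
  proof
    fix t assume t: "t \<in> J"
    have V_lim: "((\<lambda>s. V s (h t)) \<longlongrightarrow> V t (h t)) (at t within J)"
      and h_lim: "((\<lambda>s. h s - h t) \<longlongrightarrow> 0) (at t within J)"
      using strong h t by (auto simp: continuous_on LIM_zero)
    have "((\<lambda>s. V s (h s - h t)) \<longlongrightarrow> 0) (at t within J)"
    proof (rule Lim_null_comparison)
      show "\<forall>\<^sub>F s in at t within J. norm (V s (h s - h t)) \<le> M * norm (h s - h t)"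
        using M by (auto simp: eventually_at_filter)
      show "((\<lambda>s. M * norm (h s - h t)) \<longlongrightarrow> 0) (at t within J)"
        using tendsto_mult_right_zero[OF tendsto_norm_zero[OF h_lim]] .
    qed
    from tendsto_add[OF this V_lim]
    have "((\<lambda>s. V s (h s - h t) + V s (h t)) \<longlongrightarrow> V t (h t)) (at t within J)" by simp
    then show "((\<lambda>s. V s (h s)) \<longlongrightarrow> V t (h t)) (at t within J)"
      by (rule Lim_transform_eventually)
        (auto simp: eventually_at_filter linear_diff[OF bounded_linear.linear[OF V]])
  qed
qed

section \<open>Orthogonal projections onto closed subspaces\<close>

lemma projection_exists:
  fixes S :: "'a::{real_inner, banach} set"
  assumes S: "subspace S" "closed S"
  shows "\<exists>p\<in>S. \<forall>s\<in>S. (x - p) \<bullet> s = 0"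
proof -
  \<comment> \<open>A minimizing sequence for the distance from \<open>x\<close> to \<open>S\<close>
    will converge to the projection.\<close>
  define d where "d = infdist x S"
  have d: "0 \<le> d" "\<And>s. s \<in> S \<Longrightarrow> d \<le> norm (x - s)"
    by (auto simp: d_def infdist_nonneg infdist_le dist_norm[symmetric])
  have ne: "S \<noteq> {}" using subspace_0[OF S(1)] by auto
  have "\<exists>s\<in>S. norm (x - s) < d + inverse (real (Suc n))" for n
  proof -
    have "(INF s\<in>S. norm (x - s)) < d + inverse (real (Suc n))"
      by (simp add: d_def infdist_notempty[OF ne] dist_norm)
    then show ?thesis
      using cINF_less_iff[OF ne, of "\<lambda>s. norm (x - s)"] bdd_belowI2[of S 0 "\<lambda>s. norm (x - s)"] by simp
  qed
  then obtain s where s: "\<And>n. s n \<in> S" "\<And>n. norm (x - s n) < d + inverse (real (Suc n))"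
    by metis
  have "(\<lambda>n. norm (x - s n)) \<longlonglongrightarrow> d"
    by (rule tendsto_sandwich[OF _ _ tendsto_const LIMSEQ_inverse_real_of_nat_add])
      (use s d in \<open>auto intro!: always_eventually less_imp_le simp del: of_nat_Suc\<close>)
  then have lim: "(\<lambda>n. (norm (x - s n))\<^sup>2) \<longlonglongrightarrow> d\<^sup>2"
    by (rule tendsto_power)
  \<comment> \<open>Parallelogram law for \<open>x - a\<close> and \<open>x - b\<close>: the
    midpoint of \<open>a\<close> and \<open>b\<close> lies in \<open>S\<close>, hence at distance at
    least \<open>d\<close> from \<open>x\<close>. Almost minimal points are therefore close
    together, which makes \<open>s\<close> Cauchy.\<close>
  have par: "(norm (a - b))\<^sup>2 \<le> 2 * ((norm (x - a))\<^sup>2 - d\<^sup>2) + 2 * ((norm (x - b))\<^sup>2 - d\<^sup>2)"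
    if ab: "a \<in> S" "b \<in> S" for a b
  proof -
    have "d \<le> norm (x - (1/2) *\<^sub>R (a + b))"
      using ab S(1) by (intro d) (auto simp: subspace_add subspace_scale)
    then have "d\<^sup>2 \<le> (norm (x - (1/2) *\<^sub>R (a + b)))\<^sup>2" using d(1) by (rule power_mono)
    moreover have "(norm (a - b))\<^sup>2 + 4 * (norm (x - (1/2) *\<^sub>R (a + b)))\<^sup>2
        = 2 * (norm (x - a))\<^sup>2 + 2 * (norm (x - b))\<^sup>2"
      unfolding power2_norm_eq_inner by (simp add: inner_simps inner_commute algebra_simps)
    ultimately show ?thesis by simp
  qed
  have "Cauchy s"
  proof (rule metric_CauchyI)
    fix e :: real assume e: "0 < e"
    then have "\<forall>\<^sub>F n in sequentially. (norm (x - s n))\<^sup>2 < d\<^sup>2 + e\<^sup>2 / 4"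
      by (intro order_tendstoD(2)[OF lim]) auto
    then obtain N where N: "\<And>n. n \<ge> N \<Longrightarrow> (norm (x - s n))\<^sup>2 < d\<^sup>2 + e\<^sup>2 / 4"
      by (auto simp: eventually_sequentially)
    have "dist (s m) (s n) < e" if mn: "m \<ge> N" "n \<ge> N" for m n
    proof -
      have "(norm (s m - s n))\<^sup>2 < e\<^sup>2"
        using par[OF s(1) s(1), of m n] N[OF mn(1)] N[OF mn(2)] by simp
      then show ?thesis using e by (simp add: dist_norm power2_less_imp_less)
    qed
    then show "\<exists>M. \<forall>m\<ge>M. \<forall>n\<ge>M. dist (s m) (s n) < e" by blast
  qed
  then obtain p where p: "s \<longlonglongrightarrow> p" by (auto simp: Cauchy_convergent_iff convergent_def)
  have pS: "p \<in> S" using closed_sequentially[OF S(2) _ p] s by auto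
  have "(\<lambda>n. (norm (x - s n))\<^sup>2) \<longlonglongrightarrow> (norm (x - p))\<^sup>2"
    by (intro tendsto_intros p)
  then have normp: "(norm (x - p))\<^sup>2 = d\<^sup>2" using lim LIMSEQ_unique by blast
  have "(x - p) \<bullet> u = 0" if u: "u \<in> S" for u
  proof (cases "u = 0")
    case False
    define k where "k = (x - p) \<bullet> u"
    \<comment> \<open>The minimizer of the quadratic \<open>norm (x - (p + r *\<^sub>R u))\<close>
      squared. As \<open>p\<close> is already closest to \<open>x\<close>, moving along
      \<open>u\<close> gains nothing, which forces \<open>k = 0\<close>.\<close>
    define r where "r = k / (u \<bullet> u)"
    have "d \<le> norm (x - (p + r *\<^sub>R u))"
      using u pS S(1) by (intro d) (auto simp: subspace_add subspace_scale)
    then have "d\<^sup>2 \<le> (norm (x - (p + r *\<^sub>R u)))\<^sup>2" using d(1) by (rule power_mono)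
    also have "\<dots> = (norm (x - p))\<^sup>2 - 2 * r * k + r\<^sup>2 * (u \<bullet> u)"
      unfolding power2_norm_eq_inner k_def
      by (simp add: inner_simps inner_commute algebra_simps power2_eq_square)
    also have "\<dots> = d\<^sup>2 - k\<^sup>2 / (u \<bullet> u)"
      unfolding normp r_def using False by (simp add: power2_eq_square)
    finally have "k\<^sup>2 / (u \<bullet> u) \<le> 0" by simp
    then show ?thesis using False
      by (metis divide_le_0_iff inner_gt_zero_iff k_def not_le power2_less_eq_zero_iff)
  qed auto
  with pS show ?thesis by blast
qed

text \<open>Two candidates differ by a vector of \<open>S\<close> that is orthogonal to itself. With
  \<open>p = 0\<close> this turns orthogonality to \<open>S\<close> into a vanishing projection, the
  form of the final claim.\<close>

lemma orthoprojector_eqI: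
  assumes "subspace S" "p \<in> S" "\<And>s. s \<in> S \<Longrightarrow> (x - p) \<bullet> s = 0"
  shows "orthoprojector S x = p"
  unfolding orthoprojector_def
proof (rule the_equality)
  fix p' assume p': "p' \<in> S \<and> (\<forall>s\<in>S. (x - p') \<bullet> s = 0)"
  then have "p' - p \<in> S" using assms subspace_diff by blast
  then have "(x - p) \<bullet> (p' - p) - (x - p') \<bullet> (p' - p) = 0" using p' assms by simp
  then have "(p' - p) \<bullet> (p' - p) = 0" by (simp add: inner_diff_left[symmetric])
  then show "p' = p" by simp
qed (use assms in auto)

lemma orthoprojector_in:
  fixes S :: "'a::{real_inner, banach} set"
  assumes "subspace S" "closed S"
  shows "orthoprojector S x \<in> S"
  using projection_exists[OF assms, of x] orthoprojector_eqI[OF assms(1)] by metis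

lemma closed_orthogonal_comp: "closed (orthogonal_comp S)"
proof -
  have "orthogonal_comp S = (\<Inter>y\<in>S. {x. y \<bullet> x = 0})"
    by (auto simp: orthogonal_comp_def orthogonal_def)
  then show ?thesis by (auto intro!: closed_Collect_eq continuous_intros)
qed

text \<open>Both projectors in \<open>emb\<close> are definite descriptions, so membership rests on
  existence of the projections: the null space is closed because \<open>Q\<close> is bounded, the
  complement by construction.\<close>

lemma emb_in:
  fixes Q :: "'k::{real_inner, banach} \<Rightarrow> 'm::real_normed_vector"
  assumes Q: "bounded_linear Q" and j: "j ` orthogonal_comp (nullspace UNIV Q) \<subseteq> X"
  shows "emb Q j c \<in> nullspace UNIV Q \<times> X"
proof -
  have N: "nullspace UNIV Q = {c. Q c = 0}" by (simp add: nullspace_def)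
  have "subspace (nullspace UNIV Q)" "closed (nullspace UNIV Q)"
    unfolding N using bounded_linear.linear[OF Q]
    by (auto intro!: linear_subspace_kernel closed_Collect_eq bounded_linear.continuous_on[OF Q] continuous_intros)
  then have "orthoprojector (nullspace UNIV Q) c \<in> nullspace UNIV Q" by (rule orthoprojector_in)
  moreover have "orthoprojector (orthogonal_comp (nullspace UNIV Q)) c
      \<in> orthogonal_comp (nullspace UNIV Q)"
    by (intro orthoprojector_in subspace_orthogonal_comp closed_orthogonal_comp)
  ultimately show ?thesis using j by (auto simp: emb_def)
qed

text \<open>Bounded continuous functions serve below as the Banach space of right-hand sides to
  which uniform boundedness is applied.\<close>

instance bcontfun :: (metric_space, banach) banach ..

section \<open>Continuity into $C^k$\<close>

lemma deriv_on_eqI: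
  assumes "a < b" "t \<in> {a..b}" "(y has_vector_derivative y') (at t within {a..b})"
  shows "deriv_on {a..b} y t = y'"
  unfolding deriv_on_def
  using vector_derivative_within[OF _ assms(3)] assms by (simp add: trivial_limit_within)

lemma Ck_norm_Suc:
  "Ck_norm (Suc k) J y = (SUP t\<in>J. norm (y t)) + Ck_norm k J (deriv_on J y)"
  unfolding Ck_norm_def sum.atMost_Suc_shift by (simp add: funpow_Suc_right del: funpow.simps)

text \<open>Off the interval \<open>y\<close> is arbitrary: the one-sided derivatives at the
  endpoints see only values inside. This lets \<open>l\<close> ignore what total functions do
  outside \<open>J\<close>.\<close>

lemma Ck_zero:
  assumes "a < b" "\<And>t. t \<in> {a..b} \<Longrightarrow> y t = 0"
  shows "Ck_on k {a..b} y \<and> Ck_norm k {a..b} y = 0"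
  using assms(2)
proof (induction k arbitrary: y)
  case 0
  then have "continuous_on {a..b} y"
    using continuous_on_cong[of "{a..b}" "{a..b}" y "\<lambda>_. 0"] by simp
  then show ?case using 0 \<open>a < b\<close> by (simp add: Ck_norm_def)
next
  case (Suc k)
  have D: "(y has_vector_derivative 0) (at t within {a..b})" if "t \<in> {a..b}" for t
    using Suc.prems that by (intro has_vector_derivative_transform[OF that _ has_vector_derivative_const[of 0]]) auto
  have "deriv_on {a..b} y t = 0" if "t \<in> {a..b}" for t
    using deriv_on_eqI[OF \<open>a < b\<close> that D[OF that]] .
  then have IH: "Ck_on k {a..b} (deriv_on {a..b} y)" "Ck_norm k {a..b} (deriv_on {a..b} y) = 0"
    using Suc.IH by blast+
  moreover have "(SUP t\<in>{a..b}. norm (y t)) = 0" using Suc.prems \<open>a < b\<close> by simp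
  moreover have "y differentiable (at t within {a..b})" if "t \<in> {a..b}" for t
    using D[OF that] by (rule differentiableI_vector)
  ultimately show ?case
    by (simp add: Ck_norm_Suc)
qed

lemma Ck_on_imp_continuous_on: "Ck_on k J y \<Longrightarrow> continuous_on J y"
  by (cases k) (auto simp: continuous_on_eq_continuous_within intro: differentiable_imp_continuous_within)

lemma has_vector_derivative_quotient:
  assumes "(y has_vector_derivative y') (at t within S)"
  shows "((\<lambda>u. (1 / (u - t)) *\<^sub>R (y u - y t)) \<longlongrightarrow> y') (at t within S)"
proof -
  \<comment> \<open>The two quotients differ by the sign of \<open>u - t\<close>, so they agree only
    in norm.\<close>
  have *: "norm ((1 / norm (u - t)) *\<^sub>R (y u - (y t + (u - t) *\<^sub>R y')))
      = norm ((1 / (u - t)) *\<^sub>R (y u - y t) - y')" if "u \<noteq> t" for u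
  proof -
    have "(1 / (u - t)) *\<^sub>R (y u - y t) - y' = (1 / (u - t)) *\<^sub>R (y u - (y t + (u - t) *\<^sub>R y'))"
      using that by (simp add: scaleR_diff_right scaleR_add_right)
    then show ?thesis by simp
  qed
  have "((\<lambda>u. (1 / norm (u - t)) *\<^sub>R (y u - (y t + (u - t) *\<^sub>R y'))) \<longlongrightarrow> 0) (at t within S)"
    using assms unfolding has_vector_derivative_def has_derivative_within by (rule conjunct2)
  from tendsto_norm_zero[OF this] have "((\<lambda>u. norm ((1 / (u - t)) *\<^sub>R (y u - y t) - y')) \<longlongrightarrow> 0) (at t within S)"
    by (rule Lim_transform_eventually) (use * in \<open>auto simp: eventually_at_filter\<close>)
  then show ?thesis
    by (rule LIM_zero_cancel[OF tendsto_norm_zero_cancel])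
qed

text \<open>Along a fixed sequence in the interval tending to \<open>t\<close>, the difference
  quotients are bounded operators in \<open>\<phi>\<close> converging pointwise to the derivative,
  so \<open>bounded_linear_limit\<close> applies.\<close>

lemma bounded_linear_deriv_on:
  fixes T :: "'a::banach \<Rightarrow> real \<Rightarrow> 'b::real_normed_vector"
  assumes "a < b" and t: "t \<in> {a..b}"
    and T: "\<And>t. t \<in> {a..b} \<Longrightarrow> bounded_linear (\<lambda>\<phi>. T \<phi> t)"
    and diff: "\<And>\<phi>. T \<phi> differentiable (at t within {a..b})"
  shows "bounded_linear (\<lambda>\<phi>. deriv_on {a..b} (T \<phi>) t)"
proof -
  have "t islimpt {a..b}" using assms by simp
  then obtain s where s: "\<And>n. s n \<in> {a..b} - {t}" "s \<longlonglongrightarrow> t"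
    unfolding islimpt_sequential by blast
  have s_at: "filterlim s (at t within {a..b}) sequentially"
    using s by (auto simp: filterlim_at)
  show ?thesis
  proof (rule bounded_linear_limit)
    show "bounded_linear (\<lambda>\<phi>. (1 / (s n - t)) *\<^sub>R (T \<phi> (s n) - T \<phi> t))" for n
      using s t by (intro bounded_linear_const_scaleR bounded_linear_sub T) auto
    show "(\<lambda>n. (1 / (s n - t)) *\<^sub>R (T \<phi> (s n) - T \<phi> t)) \<longlonglongrightarrow> deriv_on {a..b} (T \<phi>) t" for \<phi>
    proof -
      have "(T \<phi> has_vector_derivative deriv_on {a..b} (T \<phi>) t) (at t within {a..b})"
        using diff by (simp add: deriv_on_def vector_derivative_works)
      then have "((\<lambda>u. (1 / (u - t)) *\<^sub>R (T \<phi> u - T \<phi> t)) \<longlongrightarrow> deriv_on {a..b} (T \<phi>) t) (at t within {a..b})"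
        by (rule has_vector_derivative_quotient)
      from filterlim_compose[OF this s_at] show ?thesis .
    qed
  qed
qed

text \<open>
  The closed graph theorem for maps into $C^k$: by Banach-Steinhaus, continuity of the values passes
  to the derivatives, which are pointwise limits of difference quotients.
\<close>

lemma Ck_norm_bounded:
  fixes T :: "'a::banach \<Rightarrow> real \<Rightarrow> 'b::real_normed_vector"
  assumes "a < b"
    and "\<And>t. t \<in> {a..b} \<Longrightarrow> bounded_linear (\<lambda>\<phi>. T \<phi> t)"
    and "\<And>\<phi>. Ck_on k {a..b} (T \<phi>)"
  shows "\<exists>M. \<forall>\<phi>. \<bar>Ck_norm k {a..b} (T \<phi>)\<bar> \<le> M * norm \<phi>"
  using assms(2,3)
proof (induction k arbitrary: T)
  \<comment> \<open>The estimate of order zero, shared by base and step. Here Banach-Steinhaus runs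
    over the family indexed by \<open>t\<close>, which is pointwise bounded by continuity on a
    compact interval.\<close>
  have sup: "\<exists>M. \<forall>\<phi>. \<bar>SUP t\<in>{a..b}. norm (T \<phi> t)\<bar> \<le> M * norm \<phi>"
    if T: "\<And>t. t \<in> {a..b} \<Longrightarrow> bounded_linear (\<lambda>\<phi>. T \<phi> t)"
      and cont: "\<And>\<phi>. continuous_on {a..b} (T \<phi>)" for T :: "'a \<Rightarrow> real \<Rightarrow> 'b"
  proof -
    have "\<exists>K. \<forall>t\<in>{a..b}. norm (T \<phi> t) \<le> K" for \<phi>
      using compact_imp_bounded[OF compact_continuous_image[OF cont compact_Icc]]
      by (auto simp: bounded_iff)
    then obtain M where M: "\<And>t \<phi>. t \<in> {a..b} \<Longrightarrow> norm (T \<phi> t) \<le> M * norm \<phi>"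
      using uniform_boundedness[of "{a..b}" "\<lambda>t \<phi>. T \<phi> t"] T by meson
    have "\<bar>SUP t\<in>{a..b}. norm (T \<phi> t)\<bar> \<le> M * norm \<phi>" for \<phi>
      using \<open>a < b\<close> M by (intro cSup_abs_le) auto
    then show ?thesis by blast
  qed
  {
    case 0
    then show ?case using sup[of T] by (simp add: Ck_norm_def)
  next
    case (Suc k)
    obtain M where M: "\<And>\<phi>. \<bar>SUP t\<in>{a..b}. norm (T \<phi> t)\<bar> \<le> M * norm \<phi>"
      using sup[of T] Suc.prems Ck_on_imp_continuous_on by blast
    \<comment> \<open>The derivatives form a family of the same kind, which is why the induction
      keeps \<open>T\<close> arbitrary.\<close>
    have "\<exists>M. \<forall>\<phi>. \<bar>Ck_norm k {a..b} (deriv_on {a..b} (T \<phi>))\<bar> \<le> M * norm \<phi>"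
      using Suc.prems by (intro Suc.IH bounded_linear_deriv_on \<open>a < b\<close>) auto
    then obtain M' where M': "\<And>\<phi>. \<bar>Ck_norm k {a..b} (deriv_on {a..b} (T \<phi>))\<bar> \<le> M' * norm \<phi>"
      by blast
    have "\<bar>Ck_norm (Suc k) {a..b} (T \<phi>)\<bar> \<le> (M + M') * norm \<phi>" for \<phi>
      unfolding Ck_norm_Suc distrib_right using M[of \<phi>] M'[of \<phi>] by linarith
    then show ?case by blast
  }
qed

section \<open>The boundary operator on Duhamel integrals\<close>

text \<open>The difference \<open>d\<close> vanishes on the interval, so its norms are zero and the
  bound on \<open>l\<close> gives \<open>bc l d = 0\<close>. Regularity of \<open>y\<close> follows
  from that of \<open>z\<close>.\<close>

lemma bc_cong:
  assumes "a < b" and l: "bounded_linear_C2_C1 {a..b} l"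
    and z: "in_C2_C1 {a..b} z" and eq: "\<And>t. t \<in> {a..b} \<Longrightarrow> y t = z t"
  shows "bc l y = bc l z"
proof -
  define d where "d t = y t - z t" for t
  have d1: "Ck_on 2 {a..b} (\<lambda>t. fst (d t)) \<and> Ck_norm 2 {a..b} (\<lambda>t. fst (d t)) = 0"
    using eq by (intro Ck_zero \<open>a < b\<close>) (auto simp: d_def)
  have d2: "Ck_on 1 {a..b} (\<lambda>t. snd (d t)) \<and> Ck_norm 1 {a..b} (\<lambda>t. snd (d t)) = 0"
    using eq by (intro Ck_zero \<open>a < b\<close>) (auto simp: d_def)
  obtain M where "norm (bc l d)
      \<le> M * (Ck_norm 2 {a..b} (\<lambda>t. fst (d t)) + Ck_norm 1 {a..b} (\<lambda>t. snd (d t)))"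
    using l d1 d2 unfolding bounded_linear_C2_C1_def bc_def by blast
  then have "bc l d = 0" using d1 d2 by simp
  moreover have "bc l (\<lambda>t. z t + d t) = bc l z + bc l d"
    using l z d1 d2 unfolding bounded_linear_C2_C1_def in_C2_C1_def bc_def by simp
  moreover have "(\<lambda>t. z t + d t) = y" by (simp add: d_def)
  ultimately show ?thesis by simp
qed

text \<open>The assumption \<open>C2\<close> is the gain of regularity for right-hand sides with
  zero first component; it places their Duhamel integrals where \<open>l\<close> is linear and
  bounded.\<close>

locale boundary_duhamel =
  fixes w :: real and J :: "real set"
    and D :: "'h::banach set"
    and A :: "real \<Rightarrow> 'h \<Rightarrow> 'h"
    and U :: "real \<Rightarrow> 'h \<times> 'h \<Rightarrow> 'h \<times> 'h"
    and l :: "(real \<Rightarrow> 'h) \<Rightarrow> (real \<Rightarrow> 'h) \<Rightarrow> 'm::real_normed_vector"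
  assumes w: "0 < w" and J: "J = {0..w}"
    and l: "bounded_linear_C2_C1 J l"
    and U: "evolution_operator J D A U"
    and C2: "continuous_on J \<phi> \<Longrightarrow> in_C2_C1 J (duhamel U (\<lambda>t. (0, \<phi> t)))"
begin

lemma bounded_linear_U: "t \<in> J \<Longrightarrow> bounded_linear (U t)"
  and bounded_linear_inv_U: "t \<in> J \<Longrightarrow> bounded_linear (inv (U t))"
  and continuous_on_inv_U: "continuous_on J (\<lambda>t. inv (U t) c)"
  using U unfolding evolution_operator_def by blast+

lemma compact_J: "compact J"
  by (simp add: J)

lemma duhamel_integrand_continuous:
  assumes h: "continuous_on J h" and t: "t \<in> J"
  shows "continuous_on {0..t} (\<lambda>\<tau>. U t (inv (U \<tau>) (h \<tau>)))"
proof -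
  have "continuous_on J (\<lambda>\<tau>. inv (U \<tau>) (h \<tau>))"
    using compact_J bounded_linear_inv_U continuous_on_inv_U h by (rule continuous_on_strong_apply)
  then have "continuous_on {0..t} (\<lambda>\<tau>. inv (U \<tau>) (h \<tau>))"
    using t by (auto simp: J intro: continuous_on_subset)
  then show ?thesis by (rule bounded_linear.continuous_on[OF bounded_linear_U[OF t]])
qed

lemma duhamel_integrable:
  assumes "continuous_on J h" "t \<in> J"
  shows "(\<lambda>\<tau>. U t (inv (U \<tau>) (h \<tau>))) integrable_on {0..t}"
  using duhamel_integrand_continuous[OF assms] by (rule integrable_continuous_real)

lemma linear_U_inv:
  assumes "t \<in> J" "\<tau> \<in> J"
  shows "linear (\<lambda>c. U t (inv (U \<tau>) c))"
  by (intro bounded_linear.linear bounded_linear_compose[of "U t" "inv (U \<tau>)"]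
      bounded_linear_U bounded_linear_inv_U assms)

lemma duhamel_add:
  assumes "continuous_on J h" "continuous_on J k" "t \<in> J"
  shows "duhamel U (\<lambda>\<tau>. h \<tau> + k \<tau>) t = duhamel U h t + duhamel U k t"
  unfolding duhamel_def integral_add[OF duhamel_integrable[OF assms(1,3)] duhamel_integrable[OF assms(2,3)], symmetric]
  using assms(3) by (intro integral_cong) (auto simp: J linear_add[OF linear_U_inv])

lemma duhamel_scaleR:
  assumes "t \<in> J"
  shows "duhamel U (\<lambda>\<tau>. r *\<^sub>R h \<tau>) t = r *\<^sub>R duhamel U h t"
  unfolding duhamel_def integral_cmul[symmetric]
  using assms by (intro integral_cong) (auto simp: J linear_scale[OF linear_U_inv])

lemma duhamel_cong:
  assumes "\<And>\<tau>. \<tau> \<in> J \<Longrightarrow> h \<tau> = k \<tau>" "t \<in> J"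
  shows "duhamel U h t = duhamel U k t"
  unfolding duhamel_def using assms by (intro integral_cong) (auto simp: J)

text \<open>Both \<open>g\<close> and \<open>H\<close> have zero first component, so every boundary
  value in the solvability condition is expressed through this one map.\<close>

abbreviation bd :: "(real \<Rightarrow> 'h) \<Rightarrow> 'm" where
  "bd \<phi> \<equiv> bc l (duhamel U (\<lambda>\<tau>. (0, \<phi> \<tau>)))"

text \<open>Identities for Duhamel integrals hold only for \<open>t\<close> in \<open>J\<close>,
  while \<open>l\<close> takes total functions; this bridges the gap.\<close>

lemma bc_eqI:
  assumes "continuous_on J \<phi>" "\<And>t. t \<in> J \<Longrightarrow> y t = duhamel U (\<lambda>\<tau>. (0, \<phi> \<tau>)) t"
  shows "bc l y = bd \<phi>"
  using bc_cong[OF w l[unfolded J] C2[OF assms(1), unfolded J], of y] assms(2) by (simp add: J)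

lemma bd_cong:
  assumes "continuous_on J \<phi>" "\<And>t. t \<in> J \<Longrightarrow> \<psi> t = \<phi> t"
  shows "bd \<psi> = bd \<phi>"
  using assms by (intro bc_eqI duhamel_cong) auto

lemma bd_add:
  assumes \<phi>: "continuous_on J \<phi>" and \<psi>: "continuous_on J \<psi>"
  shows "bd (\<lambda>t. \<phi> t + \<psi> t) = bd \<phi> + bd \<psi>"
proof -
  let ?y = "duhamel U (\<lambda>\<tau>. (0, \<phi> \<tau>))" and ?z = "duhamel U (\<lambda>\<tau>. (0, \<psi> \<tau>))"
  have "bc l (\<lambda>t. ?y t + ?z t) = bd (\<lambda>t. \<phi> t + \<psi> t)"
  proof (rule bc_eqI)
    show "?y t + ?z t = duhamel U (\<lambda>\<tau>. (0, \<phi> \<tau> + \<psi> \<tau>)) t" if "t \<in> J" for t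
      using duhamel_add[of "\<lambda>\<tau>. (0, \<phi> \<tau>)" "\<lambda>\<tau>. (0, \<psi> \<tau>)", OF _ _ that] assms
      by (simp add: continuous_on_Pair)
  qed (intro continuous_intros assms)
  moreover have "bc l (\<lambda>t. ?y t + ?z t) = bc l ?y + bc l ?z"
    using l C2[OF \<phi>] C2[OF \<psi>] unfolding bounded_linear_C2_C1_def in_C2_C1_def bc_def by simp
  ultimately show ?thesis by simp
qed

lemma bd_scaleR:
  assumes \<phi>: "continuous_on J \<phi>"
  shows "bd (\<lambda>t. r *\<^sub>R \<phi> t) = r *\<^sub>R bd \<phi>"
proof -
  let ?y = "duhamel U (\<lambda>\<tau>. (0, \<phi> \<tau>))"
  have "bc l (\<lambda>t. r *\<^sub>R ?y t) = bd (\<lambda>t. r *\<^sub>R \<phi> t)"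
    using assms by (intro bc_eqI) (auto simp: duhamel_scaleR[symmetric] intro!: continuous_intros)
  moreover have "bc l (\<lambda>t. r *\<^sub>R ?y t) = r *\<^sub>R bc l ?y"
    using l C2[OF \<phi>] unfolding bounded_linear_C2_C1_def in_C2_C1_def bc_def by simp
  ultimately show ?thesis by simp
qed

text \<open>The integrand is bounded by the norm of \<open>U t\<close>, a common bound for all
  \<open>inv (U \<tau>)\<close>, and the norm of \<open>\<phi>\<close>; integration adds the factor
  \<open>t\<close>.\<close>

lemma bounded_linear_duhamel:
  assumes t: "t \<in> J"
  shows "bounded_linear (\<lambda>\<phi> :: real \<Rightarrow>\<^sub>C 'h. duhamel U (\<lambda>\<tau>. (0, \<phi> \<tau>)) t)"
proof -
  have "\<exists>K. \<forall>\<tau>\<in>J. norm (inv (U \<tau>) c) \<le> K" for c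
    using compact_imp_bounded[OF compact_continuous_image[OF continuous_on_inv_U compact_J]]
    by (auto simp: bounded_iff)
  then obtain M where M: "\<And>\<tau> c. \<tau> \<in> J \<Longrightarrow> norm (inv (U \<tau>) c) \<le> M * norm c"
    using uniform_boundedness[of J "\<lambda>\<tau>. inv (U \<tau>)"] bounded_linear_inv_U by meson
  obtain N where N: "N \<ge> 0" "\<And>c. norm (U t c) \<le> norm c * N"
    using bounded_linear.nonneg_bounded[OF bounded_linear_U[OF t]] by blast
  have cont: "continuous_on J (\<lambda>\<tau>. (0, apply_bcontfun \<phi> \<tau>))" for \<phi> :: "real \<Rightarrow>\<^sub>C 'h"
    by (intro continuous_intros continuous_on_apply_bcontfun)
  show ?thesis
  proof (rule bounded_linear_intro)
    show "duhamel U (\<lambda>\<tau>. (0, apply_bcontfun (\<phi> + \<psi>) \<tau>)) t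
        = duhamel U (\<lambda>\<tau>. (0, \<phi> \<tau>)) t + duhamel U (\<lambda>\<tau>. (0, \<psi> \<tau>)) t" for \<phi> \<psi> :: "real \<Rightarrow>\<^sub>C 'h"
      using duhamel_add[OF cont cont t] by simp
    show "duhamel U (\<lambda>\<tau>. (0, apply_bcontfun (r *\<^sub>R \<phi>) \<tau>)) t
        = r *\<^sub>R duhamel U (\<lambda>\<tau>. (0, \<phi> \<tau>)) t" for r and \<phi> :: "real \<Rightarrow>\<^sub>C 'h"
      using duhamel_scaleR[OF t, of r "\<lambda>\<tau>. (0, \<phi> \<tau>)"] by simp
    fix \<phi> :: "real \<Rightarrow>\<^sub>C 'h"
    have "norm (U t (inv (U \<tau>) (0, \<phi> \<tau>))) \<le> \<bar>M\<bar> * norm \<phi> * N" if "\<tau> \<in> {0..t}" for \<tau>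
    proof -
      have "\<tau> \<in> J" using that t by (auto simp: J)
      then have "norm (inv (U \<tau>) (0, \<phi> \<tau>)) \<le> M * norm (\<phi> \<tau>)"
        using M[of \<tau> "(0, \<phi> \<tau>)"] by simp
      also have "\<dots> \<le> \<bar>M\<bar> * norm \<phi>" by (intro mult_mono norm_bounded) auto
      finally show ?thesis
        using N order_trans mult_right_mono by blast
    qed
    then have "norm (duhamel U (\<lambda>\<tau>. (0, \<phi> \<tau>)) t) \<le> \<bar>M\<bar> * norm \<phi> * N * (t - 0)"
      unfolding duhamel_def using t
      by (intro integral_bound duhamel_integrand_continuous cont) (auto simp: J)
    then show "norm (duhamel U (\<lambda>\<tau>. (0, \<phi> \<tau>)) t) \<le> norm \<phi> * (\<bar>M\<bar> * N * t)"
      by (simp add: mult_ac)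
  qed
qed

text \<open>The automatic continuity of \<open>Ck_norm_bounded\<close>, used with order 2 for the
  first component and order 1 for the second, meets the bound on \<open>l\<close>. The result is
  stated with a bound \<open>B\<close> on \<open>J\<close>, since \<open>\<phi>\<close> need not be
  bounded elsewhere.\<close>

lemma bd_bounded:
  "\<exists>M. \<forall>\<phi> B. continuous_on J \<phi> \<longrightarrow> (\<forall>t\<in>J. norm (\<phi> t) \<le> B) \<longrightarrow> norm (bd \<phi>) \<le> M * B"
proof -
  let ?T = "\<lambda>\<phi> :: real \<Rightarrow>\<^sub>C 'h. duhamel U (\<lambda>\<tau>. (0, \<phi> \<tau>))"
  have C2': "in_C2_C1 J (?T \<phi>)" for \<phi> by (intro C2 continuous_on_apply_bcontfun)
  obtain M where M: "\<And>y1 y2. Ck_on 2 J y1 \<Longrightarrow> Ck_on 1 J y2 \<Longrightarrow>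
      norm (l y1 y2) \<le> M * (Ck_norm 2 J y1 + Ck_norm 1 J y2)"
    using l unfolding bounded_linear_C2_C1_def by blast
  obtain M1 where M1: "\<And>\<phi>. \<bar>Ck_norm 2 J (\<lambda>t. fst (?T \<phi> t))\<bar> \<le> M1 * norm \<phi>"
    using Ck_norm_bounded[OF w, of "\<lambda>\<phi> t. fst (?T \<phi> t)" 2] C2' bounded_linear_duhamel
      bounded_linear_compose[OF bounded_linear_fst]
    unfolding J in_C2_C1_def by blast
  obtain M2 where M2: "\<And>\<phi>. \<bar>Ck_norm 1 J (\<lambda>t. snd (?T \<phi> t))\<bar> \<le> M2 * norm \<phi>"
    using Ck_norm_bounded[OF w, of "\<lambda>\<phi> t. snd (?T \<phi> t)" 1] C2' bounded_linear_duhamel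
      bounded_linear_compose[OF bounded_linear_snd]
    unfolding J in_C2_C1_def by blast
  have bound: "norm (bc l (?T \<phi>)) \<le> \<bar>M\<bar> * (M1 + M2) * norm \<phi>" for \<phi>
  proof -
    have "norm (bc l (?T \<phi>)) \<le> M * (Ck_norm 2 J (\<lambda>t. fst (?T \<phi> t)) + Ck_norm 1 J (\<lambda>t. snd (?T \<phi> t)))"
      using M C2'[of \<phi>] unfolding bc_def in_C2_C1_def by blast
    also have "\<dots> \<le> \<bar>M\<bar> * \<bar>Ck_norm 2 J (\<lambda>t. fst (?T \<phi> t)) + Ck_norm 1 J (\<lambda>t. snd (?T \<phi> t))\<bar>"
      by (metis abs_ge_self abs_mult)
    also have "\<dots> \<le> \<bar>M\<bar> * (M1 * norm \<phi> + M2 * norm \<phi>)"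
      using M1[of \<phi>] M2[of \<phi>] by (intro mult_left_mono) linarith+
    finally show ?thesis by (simp add: algebra_simps)
  qed
  have "norm (bd \<phi>) \<le> \<bar>\<bar>M\<bar> * (M1 + M2)\<bar> * B"
    if \<phi>: "continuous_on J \<phi>" and B: "\<forall>t\<in>J. norm (\<phi> t) \<le> B" for \<phi> B
  proof -
    \<comment> \<open>Clamping the argument to \<open>J\<close> extends \<open>\<phi>\<close> to a
      bounded continuous function on the line without enlarging its supremum or changing
      \<open>bd\<close>.\<close>
    obtain \<psi> :: "real \<Rightarrow>\<^sub>C 'h" where \<psi>: "\<And>t. t \<in> cbox 0 w \<Longrightarrow> \<psi> t = \<phi> t" "\<And>t. \<psi> t = \<phi> (clamp 0 w t)"
      using continuous_on_cbox_bcontfunE[of 0 w \<phi>] \<phi> by (auto simp: J)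
    have "norm \<psi> \<le> B"
      using B w clamp_in_interval[of 0 w] by (intro norm_bound) (auto simp: \<psi>(2) J)
    have "bd \<phi> = bc l (?T \<psi>)"
      using \<psi>(1) by (intro bd_cong) (auto simp: J)
    then have "norm (bd \<phi>) \<le> \<bar>M\<bar> * (M1 + M2) * norm \<psi>" using bound by simp
    also have "\<dots> \<le> \<bar>\<bar>M\<bar> * (M1 + M2)\<bar> * norm \<psi>" by (intro mult_right_mono) auto
    also have "\<dots> \<le> \<bar>\<bar>M\<bar> * (M1 + M2)\<bar> * B" using \<open>norm \<psi> \<le> B\<close> by (intro mult_left_mono) auto
    finally show ?thesis .
  qed
  then show ?thesis by blast
qed

lemma bd_tendsto:
  assumes \<Phi>: "\<And>n. continuous_on J (\<Phi> n)" and \<phi>: "continuous_on J \<phi>"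
    and lim: "uniform_limit J \<Phi> \<phi> F"
  shows "((\<lambda>n. bd (\<Phi> n)) \<longlongrightarrow> bd \<phi>) F"
proof -
  obtain M where M: "\<And>\<phi> B. continuous_on J \<phi> \<Longrightarrow> \<forall>t\<in>J. norm (\<phi> t) \<le> B \<Longrightarrow> norm (bd \<phi>) \<le> M * B"
    using bd_bounded by blast
  show ?thesis
  proof (rule tendstoI)
    fix e :: real assume e: "0 < e"
    \<comment> \<open>The summand 1 keeps the denominator positive and makes
      \<open>M * \<delta> < e\<close> strict.\<close>
    define \<delta> where "\<delta> = e / (\<bar>M\<bar> + 1)"
    have \<delta>: "0 < \<delta>" using e by (simp add: \<delta>_def)
    have "\<forall>\<^sub>F n in F. \<forall>t\<in>J. dist (\<Phi> n t) (\<phi> t) < \<delta>"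
      using uniform_limitD[OF lim \<delta>] .
    then show "\<forall>\<^sub>F n in F. dist (bd (\<Phi> n)) (bd \<phi>) < e"
    proof eventually_elim
      case (elim n)
      have "bd (\<lambda>t. \<Phi> n t + (-1) *\<^sub>R \<phi> t) = bd (\<Phi> n) + (-1) *\<^sub>R bd \<phi>"
        using \<Phi>[of n] \<phi> by (simp only: bd_add bd_scaleR continuous_on_scaleR continuous_on_const)
      moreover have "norm (bd (\<lambda>t. \<Phi> n t + (-1) *\<^sub>R \<phi> t)) \<le> M * \<delta>"
        using elim \<Phi>[of n] \<phi> by (intro M continuous_intros) (auto simp: dist_norm less_imp_le)
      moreover have "M * \<delta> < e"
      proof -
        have "M * \<delta> < (\<bar>M\<bar> + 1) * \<delta>" using \<delta> by (intro mult_strict_right_mono) auto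
        then show ?thesis by (simp add: \<delta>_def)
      qed
      ultimately show ?case by (simp add: dist_norm)
    qed
  qed
qed

end

section \<open>Necessity of the equation for the generating elements\<close>

theorem theorem2:
  fixes w q \<epsilon>0 :: real
    and J :: "real set"
    and D :: "'h::{real_inner, banach, second_countable_topology} set"
    and A :: "real \<Rightarrow> 'h \<Rightarrow> 'h"
    and U :: "real \<Rightarrow> 'h \<times> 'h \<Rightarrow> 'h \<times> 'h"
    and f :: "real \<Rightarrow> 'h"
    and g :: "real \<Rightarrow> 'h \<times> 'h"
    and l :: "(real \<Rightarrow> 'h) \<Rightarrow> (real \<Rightarrow> 'h) \<Rightarrow> 'm::{real_inner, banach}"
    and \<alpha> g1 :: 'm
    and Q :: "'h \<times> 'h \<Rightarrow> 'm"
    and j :: "'h \<times> 'h \<Rightarrow> 'x::real_inner"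
    and Xbar :: "'x set"
    and Qcal :: "'x \<Rightarrow> 'm"
    and Kbar :: "(('h \<times> 'h) \<times> 'x) set"
    and Qbar :: "('h \<times> 'h) \<times> 'x \<Rightarrow> 'm"
    and Ubar :: "real \<Rightarrow> ('h \<times> 'h) \<times> 'x \<Rightarrow> ('h \<times> 'h) \<times> 'x"
    and Z :: "real \<Rightarrow> 'h \<Rightarrow> 'h \<Rightarrow> 'h"
    and Zbar :: "real \<Rightarrow> ('h \<times> 'h) \<times> 'x \<Rightarrow> 'h"
    and H :: "real \<Rightarrow> ('h \<times> 'h) \<times> 'x \<Rightarrow> 'h \<times> 'h"
    and x0 :: "real \<Rightarrow> ('h \<times> 'h) \<times> 'x \<Rightarrow> ('h \<times> 'h) \<times> 'x"
    and x :: "real \<Rightarrow> real \<Rightarrow> ('h \<times> 'h) \<times> 'x"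
    and c0 :: "('h \<times> 'h) \<times> 'x"
  assumes "0 < w" and J: "J = {0..w}"
    and "closed_operator_family J D A"
    and "continuous_on J f"
    and "bounded_linear_C2_C1 J l"
    and "evolution_operator J D A U"
    and "is_lU D l U Q"
    and "\<And>\<phi>. continuous_on J \<phi> \<Longrightarrow> in_C2_C1 J (duhamel U (\<lambda>t. (0, \<phi> t)))"
    and g: "g = (\<lambda>t. (0, f t))"
    and g1: "g1 = \<alpha> - bc l (duhamel U g)"
    and "is_completion (orthogonal_comp (nullspace UNIV Q)) (\<lambda>x. norm (Q x)) j Xbar"
    and "extends_by_continuity (orthogonal_comp (nullspace UNIV Q)) Q j Xbar Qcal"
    and Kbar: "Kbar = nullspace UNIV Q \<times> Xbar"
    and Qbar: "Qbar = (\<lambda>c. Qcal (snd c))"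
    and "\<And>t. t \<in> J \<Longrightarrow> Ubar t ` Kbar \<subseteq> Kbar \<and>
           extends_by_continuity UNIV (\<lambda>c. emb Q j (U t c)) (emb Q j) Kbar (Ubar t)"
    and x0: "x0 = (\<lambda>t c. Ubar t (orthoprojector (nullspace Kbar Qbar) c)
                 + Ubar t (pseudoinverse Kbar Qbar g1) + emb Q j (duhamel U g t))"
    and H: "H = (\<lambda>t x. (0, Zbar t x))"
    and "c0 \<in> Kbar"
    and "0 < q" and "smooth_nonlinearity J Kbar (emb Q j) q (\<lambda>t. x0 t c0) Z Zbar"
    and "0 < \<epsilon>0"
    and "\<And>\<epsilon>. \<epsilon> \<in> {0..\<epsilon>0} \<Longrightarrow>
           strong_generalized_solution J l U Kbar Qbar (emb Q j) Ubar \<alpha>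
             (\<lambda>t. g t + \<epsilon> *\<^sub>R H t (x t \<epsilon>)) (\<lambda>t. x t \<epsilon>)"
    and "continuous_on (J \<times> {0..\<epsilon>0}) (\<lambda>(t, \<epsilon>). x t \<epsilon>)"
    and "\<And>t. t \<in> J \<Longrightarrow> x t 0 = x0 t c0"
  shows "orthoprojector (orthogonal_comp (Qbar ` Kbar))
           (bc l (duhamel U (\<lambda>\<tau>. H \<tau> (x0 \<tau> c0)))) = 0"
proof -
  note l = assms(5) and U = assms(6) and Q = assms(7) and C2 = assms(8)
  note completion = assms(11) and Ubar = assms(15) and Zbar = assms(20)
  note sol = assms(22) and cont = assms(23) and x_0 = assms(24)
  interpret boundary_duhamel w J D A U l
    by unfold_locales (fact \<open>0 < w\<close> J l U C2)+
  have "bounded_linear Q" using Q by (simp add: is_lU_def)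
  then have emb: "emb Q j c \<in> Kbar" for c
    using completion unfolding Kbar is_completion_def by (intro emb_in) auto
  have "linear Q" using \<open>bounded_linear Q\<close> bounded_linear.linear by blast
  then have "subspace Kbar"
    using completion unfolding Kbar is_completion_def nullspace_def
    by (auto intro!: subspace_Times linear_subspace_kernel)
  \<comment> \<open>The tube consists of points of \<open>Kbar\<close>, so membership must be read
    off the solution formula, both of whose terms lie in this subspace.\<close>
  have xK: "x t \<epsilon> \<in> Kbar" if t: "t \<in> J" and \<epsilon>: "\<epsilon> \<in> {0..\<epsilon>0}" for t \<epsilon>
  proof -
    obtain c where "c \<in> Kbar"
      "x t \<epsilon> = Ubar t c + emb Q j (duhamel U (\<lambda>t. g t + \<epsilon> *\<^sub>R H t (x t \<epsilon>)) t)"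
      using sol[OF \<epsilon>] t unfolding strong_generalized_solution_def by blast
    moreover from this have "Ubar t c \<in> Kbar" using Ubar[OF t] by blast
    ultimately show ?thesis
      using subspace_add[OF \<open>subspace Kbar\<close> _ emb] by presburger
  qed
  \<comment> \<open>Uniform continuity on a compact rectangle gives one threshold for all
    \<open>t\<close>: for small \<open>\<epsilon>\<close> the whole solution stays within
    \<open>q\<close> of \<open>x t 0\<close>, the generating solution.\<close>
  obtain \<delta>0 where \<delta>0: "0 < \<delta>0"
    "\<And>z z'. z \<in> J \<times> {0..\<epsilon>0} \<Longrightarrow> z' \<in> J \<times> {0..\<epsilon>0} \<Longrightarrow> dist z' z < \<delta>0 \<Longrightarrow>
      dist (x (fst z') (snd z')) (x (fst z) (snd z)) < q"
  proof -
    have "uniformly_continuous_on (J \<times> {0..\<epsilon>0}) (\<lambda>z. x (fst z) (snd z))"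
      using compact_uniformly_continuous[OF cont] by (simp add: compact_J compact_Times case_prod_unfold)
    then show thesis
      using that \<open>0 < q\<close> unfolding uniformly_continuous_on_def by blast
  qed
  define \<delta> where "\<delta> = min \<epsilon>0 (\<delta>0 / 2)"
  have \<delta>: "0 < \<delta>" "\<delta> \<le> \<epsilon>0" "\<delta> < \<delta>0" using \<delta>0(1) \<open>0 < \<epsilon>0\<close> by (auto simp: \<delta>_def)
  have tube: "(t, x t \<epsilon>) \<in> tube J Kbar q (\<lambda>t. x0 t c0)" if "t \<in> J" "\<epsilon> \<in> {0..\<delta>}" for t \<epsilon>
    using \<delta>0(2)[of "(t, 0)" "(t, \<epsilon>)"] that \<delta> xK x_0 by (auto simp: tube_def dist_Pair_Pair)
  define \<phi> where "\<phi> \<epsilon> t = Zbar t (x t \<epsilon>)" for \<epsilon> t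
  \<comment> \<open>Joint continuity in time and parameter is what upgrades convergence as the
    parameter tends to 0 to uniform convergence on \<open>J\<close>.\<close>
  have cont_\<phi>2: "continuous_on (J \<times> {0..\<delta>}) (\<lambda>z. \<phi> (snd z) (fst z))"
  proof -
    have "continuous_on (tube J Kbar q (\<lambda>t. x0 t c0)) (\<lambda>z. Zbar (fst z) (snd z))"
      using Zbar by (simp add: smooth_nonlinearity_def case_prod_unfold)
    moreover have "continuous_on (J \<times> {0..\<delta>}) (\<lambda>z. x (fst z) (snd z))"
      using \<delta> by (intro continuous_on_subset[OF cont[unfolded case_prod_unfold]]) auto
    ultimately show ?thesis
      unfolding \<phi>_def using tube
      by (intro continuous_on_compose2[of _ "\<lambda>z. Zbar (fst z) (snd z)" _ "\<lambda>z. (fst z, x (fst z) (snd z))", simplified]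
          continuous_intros) auto
  qed
  have cont_\<phi>: "continuous_on J (\<phi> \<epsilon>)" if "\<epsilon> \<in> {0..\<delta>}" for \<epsilon>
    using continuous_on_compose2[OF cont_\<phi>2, of J "\<lambda>t. (t, \<epsilon>)"] that
    by (simp add: image_subset_iff continuous_on_Pair)
  \<comment> \<open>Every term is nonzero, to allow division, and at most \<open>\<delta>\<close>,
    so that all \<open>\<phi> (\<epsilon> n)\<close> are continuous as \<open>bd_tendsto\<close>
    demands.\<close>
  define \<epsilon> where "\<epsilon> n = \<delta> / real (Suc n)" for n
  have \<epsilon>: "\<epsilon> n \<in> {0..\<delta>}" "\<epsilon> n \<noteq> 0" for n using \<delta> by (auto simp: \<epsilon>_def field_simps)
  have "\<epsilon> \<longlonglongrightarrow> 0"
    using tendsto_mult_right_zero[OF LIMSEQ_inverse_real_of_nat, of \<delta>]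
    by (simp add: \<epsilon>_def[abs_def] divide_inverse)
  have "uniform_limit J (\<lambda>n. \<phi> (\<epsilon> n)) (\<phi> 0) sequentially"
  proof (rule uniform_limitI)
    fix e :: real assume "0 < e"
    then obtain d where d: "0 < d"
      "\<And>z z'. z \<in> J \<times> {0..\<delta>} \<Longrightarrow> z' \<in> J \<times> {0..\<delta>} \<Longrightarrow> dist z' z < d \<Longrightarrow>
        dist (\<phi> (snd z') (fst z')) (\<phi> (snd z) (fst z)) < e"
    proof -
      have "uniformly_continuous_on (J \<times> {0..\<delta>}) (\<lambda>z. \<phi> (snd z) (fst z))"
        using compact_uniformly_continuous[OF cont_\<phi>2] by (simp add: compact_J compact_Times)
      then show thesis
        using that \<open>0 < e\<close> unfolding uniformly_continuous_on_def by blast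
    qed
    have "\<forall>\<^sub>F n in sequentially. dist (\<epsilon> n) 0 < d" using tendstoD[OF \<open>\<epsilon> \<longlonglongrightarrow> 0\<close> d(1)] .
    then show "\<forall>\<^sub>F n in sequentially. \<forall>t\<in>J. dist (\<phi> (\<epsilon> n) t) (\<phi> 0 t) < e"
    proof eventually_elim
      case (elim n)
      then show ?case using d(2)[of "(_, 0)" "(_, \<epsilon> n)"] \<epsilon>[of n] \<delta>(1) by (auto simp: dist_Pair_Pair)
    qed
  qed
  then have lim: "(\<lambda>n. bd (\<phi> (\<epsilon> n))) \<longlonglongrightarrow> bd (\<phi> 0)"
    using \<epsilon> \<delta> by (intro bd_tendsto cont_\<phi>) auto
  \<comment> \<open>The solvability condition with the boundary value split by linearity. The case
    \<open>e = 0\<close> is the condition of the generating problem.\<close>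
  have range: "\<exists>c\<in>Kbar. Qbar c = \<alpha> - (bd f + e *\<^sub>R bd (\<phi> e))" if e: "e \<in> {0..\<delta>}" for e
  proof -
    have "(\<lambda>t. g t + e *\<^sub>R H t (x t e)) = (\<lambda>t. (0, f t + e *\<^sub>R \<phi> e t))"
      by (simp add: g H \<phi>_def)
    moreover have "bd (\<lambda>t. f t + e *\<^sub>R \<phi> e t) = bd f + e *\<^sub>R bd (\<phi> e)"
      using \<open>continuous_on J f\<close> cont_\<phi>[OF e]
      by (simp add: bd_add bd_scaleR continuous_on_scaleR continuous_on_const)
    ultimately show ?thesis
      using sol[of e] e \<delta> unfolding strong_generalized_solution_def by auto
  qed
  have orth: "bd (\<phi> 0) \<bullet> s = 0" if s: "s \<in> orthogonal_comp (Qbar ` Kbar)" for s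
  proof -
    have s0: "Qbar c \<bullet> s = 0" if "c \<in> Kbar" for c
      using s that by (auto simp: orthogonal_comp_def orthogonal_def)
    have eq: "(\<alpha> - (bd f + e *\<^sub>R bd (\<phi> e))) \<bullet> s = 0" if "e \<in> {0..\<delta>}" for e
      using range[OF that] s0 by metis
    have "bd (\<phi> (\<epsilon> n)) \<bullet> s = 0" for n
      \<comment> \<open>Subtracting the condition at 0 cancels \<open>\<alpha> - bd f\<close> and
        leaves \<open>\<epsilon> n\<close> times the wanted inner product.\<close>
      using eq[of 0] eq[OF \<epsilon>(1)[of n]] \<epsilon>(2)[of n] \<delta>(1) by (simp add: inner_diff_left inner_add_left)
    then show ?thesis
      using tendsto_inner[OF lim tendsto_const[of s]] by (simp add: LIMSEQ_const_iff)
  qed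
  \<comment> \<open>Since \<open>x t 0\<close> equals \<open>x0 t c0\<close> only for
    \<open>t\<close> in \<open>J\<close>, the congruence rules are needed instead of plain
    rewriting.\<close>
  have "bc l (duhamel U (\<lambda>\<tau>. H \<tau> (x0 \<tau> c0))) = bd (\<phi> 0)"
    using \<delta> x_0 by (intro bc_eqI duhamel_cong cont_\<phi>) (auto simp: H \<phi>_def)
  then show ?thesis
    using orth by (intro orthoprojector_eqI subspace_orthogonal_comp) (auto simp: subspace_0 subspace_orthogonal_comp)
qed

end
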